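(* For every $n\in\mathbb N$ and $j\in\{1,\dots,n\}$, $$P(\mathcal F_n=j)=\begin{cases}\dfrac{B_{n-1}}{B_n} & \text{if } j=1,\\[2mm] \dfrac{j\,\Theta_{n-j-1}(j)}{B_n} & \text{if } 1<j<n,\\[2mm] \dfrac{1}{B_n} & \text{if } j=n.\end{cases}$$ In particular, for $n\ge 2$, $$E(\mathcal F_n)=\frac{n+\sum_{j=1}^{n-1}j^2\,\Theta_{n-j-1}(j)}{B_n}.$$
   Context: $\mathbb N=\{1,2,\dots\}$. A restricted growth sequence of length $n\ge 1$ is a sequence $\pi=\pi_1\pi_2\cdots\pi_n$ of positive integers with $\pi_1=1$ and $\pi_{j+1}\le 1+\max\{\pi_1,\dots,\pi_j\}$ for all $1\le j<n$. The set of all of them is denoted $\mathcal R_n$; its cardinality is the $n$-th Bell number $B_n$ (with $B_0=1$). An index $i\in\{1,\dots,n\}$ is a fixed point of $\pi$ if $\pi_i=i$, and $\mathcal F_\pi$ denotes the number of fixed points of $\pi$. The random variable $\mathcal F_n$ is $\mathcal F_\pi$ for $\pi$ chosen uniformly at random from $\mathcal R_n$ (each sequence having probability $1/B_n$); $P$ and $E$ denote the corresponding probability and expectation. For integers $n,t\ge 0$, $$\Theta_n(t):=\frac1e\sum_{m=t}^\infty\frac{m^n}{(m-t)!}=\sum_{\ell=0}^n\binom{n}{\ell}t^{n-\ell}B_\ell,$$ with the convention $0^0=1$. (When $n=1$, the cases $j=1$ and $j=n$ coincide and give the same value.) *)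

theory Defs
  imports "HOL-Probability.Probability"
begin

text \<open>Sequences are lists, so the entry \<open>\<pi>\<^sub>i\<close> (\<open>1 \<le> i \<le> n\<close>) is \<open>\<pi> ! (i - 1)\<close> and
  \<open>{\<pi>\<^sub>1, \<dots>, \<pi>\<^sub>j}\<close> is \<open>set (take j \<pi>)\<close>. Restricted growth sequences have length at least 1,
  so \<open>RGS 0\<close> is empty and the value \<open>Bell 0 = 1\<close> is set separately.\<close>

definition restricted_growth :: "nat list \<Rightarrow> bool" where
  "restricted_growth \<pi> \<longleftrightarrow>
     \<pi> \<noteq> [] \<and> (\<forall>x\<in>set \<pi>. 1 \<le> x) \<and> \<pi> ! 0 = 1 \<and>
     (\<forall>j. 1 \<le> j \<and> j < length \<pi> \<longrightarrow> \<pi> ! j \<le> 1 + Max (set (take j \<pi>)))"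

definition RGS :: "nat \<Rightarrow> nat list set" where
  "RGS n = {\<pi>. length \<pi> = n \<and> restricted_growth \<pi>}"

definition Bell :: "nat \<Rightarrow> nat" where
  "Bell n = (if n = 0 then 1 else card (RGS n))"

definition fixed_points :: "nat list \<Rightarrow> nat" where
  "fixed_points \<pi> = card {i \<in> {1..length \<pi>}. \<pi> ! (i - 1) = i}"

definition Theta :: "nat \<Rightarrow> nat \<Rightarrow> real" where
  "Theta n t = 1 / exp 1 * (\<Sum>\<^sub>\<infinity>m\<in>{t..}. real m ^ n / fact (m - t))"

text \<open>\<open>pmf_of_set\<close> is the uniform distribution only on finite nonempty sets.\<close>

lemma finite_RGS: "finite (RGS n)"
proof -
  have bound: "\<pi> ! i \<le> Suc i" if "restricted_growth \<pi>" "i < length \<pi>" for \<pi> i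
    using that(2)
  proof (induction i rule: less_induct)
    case (less i)
    show ?case
    proof (cases "i = 0")
      case True
      then show ?thesis using that(1) by (simp add: restricted_growth_def)
    next
      case False
      have ne: "set (take i \<pi>) \<noteq> {}" using False less.prems by auto
      have "x \<le> i" if "x \<in> set (take i \<pi>)" for x
      proof -
        from that obtain k where "k < i" "x = \<pi> ! k"
          by (auto simp: in_set_conv_nth)
        then show ?thesis using less.IH[of k] less.prems by simp
      qed
      then have "Max (set (take i \<pi>)) \<le> i" using ne by (subst Max_le_iff) auto
      moreover have "\<pi> ! i \<le> 1 + Max (set (take i \<pi>))"
        using that(1) False less.prems by (simp add: restricted_growth_def)
      ultimately show ?thesis by simp
    qed
  qed
  have "RGS n \<subseteq> {\<pi>. set \<pi> \<subseteq> {..n} \<and> length \<pi> = n}"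
  proof
    fix \<pi> assume "\<pi> \<in> RGS n"
    then have *: "length \<pi> = n" "restricted_growth \<pi>" by (auto simp: RGS_def)
    have "x \<le> n" if "x \<in> set \<pi>" for x
    proof -
      from that obtain k where "k < n" "x = \<pi> ! k" using * by (auto simp: in_set_conv_nth)
      then show ?thesis using bound[of \<pi> k] * by simp
    qed
    then show "\<pi> \<in> {\<pi>. set \<pi> \<subseteq> {..n} \<and> length \<pi> = n}" using * by auto
  qed
  then show ?thesis by (rule finite_subset) (simp add: finite_lists_length_eq)
qed

lemma RGS_nonempty:
  assumes "n \<ge> 1"
  shows "RGS n \<noteq> {}"
proof -
  have "replicate n 1 \<in> RGS n"
    using assms by (auto simp: RGS_def restricted_growth_def)
  then show ?thesis by blast
qed

end

theory Submission
  imports Defs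
begin

text \<open>
  Reading a restricted growth sequence from the left, the only thing that limits the next entry is
  the current maximum \<open>m\<close>: the entry is one of \<open>1, \<dots>, m\<close>, which keeps the maximum, or \<open>m + 1\<close>,
  which raises it. Hence the number \<open>W n m\<close> of continuations of length \<open>n\<close> satisfies
  \<open>W 0 m = 1\<close> and \<open>W (n + 1) m = m W n m + W n (m + 1)\<close>. Splitting one factor of \<open>k\<^sup>n\<^sup>+\<^sup>1\<close> as
  \<open>k = m + (k - m)\<close> in the series shows that \<open>\<Theta>\<^sub>n(m)\<close> obeys the same recurrence with the same
  initial value, so \<open>W n m = \<Theta>\<^sub>n(m)\<close> (\<open>Theta_eq_card_growth_words\<close>); the case \<open>m = 0\<close> is
  Dobinski's formula for the Bell numbers.

  The maximum of the first \<open>i\<close> entries is at most \<open>i\<close>, so an entry can be a fixed point only if the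
  maximum has been raised in every earlier step. The fixed points therefore form an initial
  segment: a sequence of length \<open>n\<close> with exactly \<open>j < n\<close> fixed points starts with \<open>1, \<dots>, j\<close>,
  continues with one of the \<open>j\<close> entries that are at most \<open>j\<close>, and then with an arbitrary
  continuation of length \<open>n - j - 1\<close> from maximum \<open>j\<close>. That gives \<open>j \<Theta>\<^bsub>n-j-1\<^esub>(j)\<close> sequences
  (\<open>card_exactly_fixed\<close>), while \<open>1, \<dots>, n\<close> is the only one with \<open>n\<close> fixed points.
\<close>

section \<open>Continuations of restricted growth sequences\<close>

text \<open>Making the current maximum \<open>m\<close> a parameter is what gives the count a recurrence; restricted
  growth sequences are the continuations of the empty sequence, whose maximum is taken to be 0.\<close>

fun growth_from :: "nat \<Rightarrow> nat list \<Rightarrow> bool" where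
  "growth_from m [] \<longleftrightarrow> True"
| "growth_from m (x # xs) \<longleftrightarrow> 1 \<le> x \<and> x \<le> Suc m \<and> growth_from (max m x) xs"

definition growth_words :: "nat \<Rightarrow> nat \<Rightarrow> nat list set" where
  "growth_words n m = {xs. length xs = n \<and> growth_from m xs}"

lemma growth_from_iff_Max:
  "growth_from m xs \<longleftrightarrow> (\<forall>x\<in>set xs. 1 \<le> x) \<and>
     (\<forall>j<length xs. xs ! j \<le> 1 + Max (insert m (set (take j xs))))"
proof (induction xs arbitrary: m)
  case Nil
  then show ?case by simp
next
  case (Cons x xs)
  have "Max (insert (max m x) A) = Max (insert m (insert x A))" if "finite A" for A
    using that by (cases "A = {}") (simp_all add: max.assoc)
  then show ?case
    unfolding growth_from.simps Cons.IH by (auto simp: All_less_Suc2 simp del: Max_insert)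
qed

lemma restricted_growth_iff_growth_from:
  "restricted_growth \<pi> \<longleftrightarrow> \<pi> \<noteq> [] \<and> growth_from 0 \<pi>"
proof (cases \<pi>)
  case Nil
  then show ?thesis by (simp add: restricted_growth_def)
next
  case (Cons x xs)
  have eq: "Max (insert 0 (set (take j \<pi>))) = Max (set (take j \<pi>))" if "1 \<le> j" for j
    using that Cons by (subst Max_insert) auto
  have "growth_from 0 \<pi> \<longleftrightarrow> (\<forall>x\<in>set \<pi>. 1 \<le> x) \<and> \<pi> ! 0 \<le> 1 \<and>
     (\<forall>j. 1 \<le> j \<and> j < length \<pi> \<longrightarrow> \<pi> ! j \<le> 1 + Max (insert 0 (set (take j \<pi>))))"
    unfolding growth_from_iff_Max using Cons
    by (auto simp: All_less_Suc2 Suc_le_eq gr0_conv_Suc simp del: Max_insert)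
  also have "\<dots> \<longleftrightarrow> (\<forall>x\<in>set \<pi>. 1 \<le> x) \<and> \<pi> ! 0 \<le> 1 \<and>
     (\<forall>j. 1 \<le> j \<and> j < length \<pi> \<longrightarrow> \<pi> ! j \<le> 1 + Max (set (take j \<pi>)))"
    using eq by metis
  also have "\<dots> \<longleftrightarrow> restricted_growth \<pi>"
    unfolding restricted_growth_def using Cons by auto
  finally show ?thesis using Cons by auto
qed

lemma RGS_eq_growth_words: "1 \<le> n \<Longrightarrow> RGS n = growth_words n 0"
  by (auto simp: RGS_def growth_words_def restricted_growth_iff_growth_from)

lemma growth_words_0: "growth_words 0 m = {[]}"
  by (auto simp: growth_words_def)

text \<open>The first summand collects the words whose first entry keeps the maximum, the second those
  whose first entry raises it.\<close>

lemma growth_words_Suc: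
  "growth_words (Suc n) m =
     (\<lambda>(x, xs). x # xs) ` ({1..m} \<times> growth_words n m) \<union> (#) (Suc m) ` growth_words n (Suc m)"
  (is "_ = ?A \<union> ?B")
proof (intro set_eqI iffI)
  fix ys assume "ys \<in> growth_words (Suc n) m"
  then obtain x xs where ys: "ys = x # xs" "length xs = n" "1 \<le> x" "x \<le> Suc m"
      "growth_from (max m x) xs"
    by (auto simp: growth_words_def length_Suc_conv)
  show "ys \<in> ?A \<union> ?B"
  proof (cases "x = Suc m")
    case True
    then show ?thesis using ys by (auto simp: growth_words_def)
  next
    case False
    then have "x \<in> {1..m}" "max m x = m" using ys by auto
    then show ?thesis using ys by (auto simp: growth_words_def)
  qed
qed (auto simp: growth_words_def max_def)

lemma finite_growth_words: "finite (growth_words n m)"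
  by (induction n arbitrary: m) (simp_all add: growth_words_0 growth_words_Suc)

lemma card_keep_maximum:
  "card ((\<lambda>(x, xs). x # xs) ` ({1..m} \<times> growth_words n m)) = m * card (growth_words n m)"
  by (subst card_image) (auto simp: inj_on_def card_cartesian_product)

lemma card_growth_words_Suc:
  "card (growth_words (Suc n) m) = m * card (growth_words n m) + card (growth_words n (Suc m))"
proof -
  have "card ((#) (Suc m) ` growth_words n (Suc m)) = card (growth_words n (Suc m))"
    by (simp add: card_image)
  moreover have "card (growth_words (Suc n) m) =
      card ((\<lambda>(x, xs). x # xs) ` ({1..m} \<times> growth_words n m))
        + card ((#) (Suc m) ` growth_words n (Suc m))"
    unfolding growth_words_Suc by (rule card_Un_disjoint) (auto simp: finite_growth_words)
  ultimately show ?thesis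
    by (simp only: card_keep_maximum)
qed

section \<open>The series as a counting function\<close>

text \<open>With the summation index shifted to start at 0, the recurrence of the series comes from
  \<open>(k + m)\<^sup>n\<^sup>+\<^sup>1 / k! = m (k + m)\<^sup>n / k! + (k + m)\<^sup>n / (k - 1)!\<close>, whose last term is 0 for \<open>k = 0\<close>.\<close>

lemma sums_card_growth_words:
  "(\<lambda>k. real (k + m) ^ n / fact k) sums (exp 1 * real (card (growth_words n m)))"
proof (induction n arbitrary: m)
  case 0
  show ?case
    using exp_converges[of "1 :: real"] by (simp add: growth_words_0 field_simps)
next
  case (Suc n)
  define g where "g k = real k * real (k + m) ^ n / fact k" for k
  have "g (Suc k) = real (k + Suc m) ^ n / fact k" for k
    unfolding g_def by (simp add: divide_simps)
  then have "(\<lambda>k. g (Suc k)) sums (exp 1 * real (card (growth_words n (Suc m))))"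
    using Suc.IH[of "Suc m"] by simp
  then have g: "g sums (exp 1 * real (card (growth_words n (Suc m))))"
    by (subst (asm) sums_Suc_iff) (simp add: g_def)
  have "(\<lambda>k. real m * (real (k + m) ^ n / fact k) + g k) sums
      (real m * (exp 1 * real (card (growth_words n m)))
        + exp 1 * real (card (growth_words n (Suc m))))"
    by (intro sums_add sums_mult Suc.IH g)
  moreover have "real m * (real (k + m) ^ n / fact k) + g k = real (k + m) ^ Suc n / fact k" for k
    unfolding g_def by (simp add: field_simps)
  ultimately show ?case
    by (simp add: card_growth_words_Suc algebra_simps)
qed

lemma Theta_eq_card_growth_words: "Theta n m = real (card (growth_words n m))"
proof -
  have "((\<lambda>k. real (k + m) ^ n / fact k) has_sum (exp 1 * real (card (growth_words n m)))) UNIV"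
    by (rule sums_nonneg_imp_has_sum[OF sums_card_growth_words]) simp
  then have "(\<Sum>\<^sub>\<infinity>k. real (k + m) ^ n / fact k) = exp 1 * real (card (growth_words n m))"
    by (rule infsumI)
  also have "(\<Sum>\<^sub>\<infinity>k. real (k + m) ^ n / fact k) = (\<Sum>\<^sub>\<infinity>k\<in>{m..}. real k ^ n / fact (k - m))"
    by (rule infsum_reindex_bij_witness[of _ "\<lambda>k. k - m" "\<lambda>k. k + m"]) auto
  finally show ?thesis by (simp add: Theta_def)
qed

lemma Bell_eq_card_growth_words: "Bell n = card (growth_words n 0)"
  by (cases "n = 0") (simp_all add: Bell_def growth_words_0 RGS_eq_growth_words)

section \<open>Counting fixed points\<close>

text \<open>The counterpart of \<open>fixed_points\<close> for a word that is preceded by \<open>m\<close> entries.\<close>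

fun fixed_from :: "nat \<Rightarrow> nat list \<Rightarrow> nat" where
  "fixed_from m [] = 0"
| "fixed_from m (x # xs) = (if x = Suc m then 1 else 0) + fixed_from (Suc m) xs"

lemma fixed_from_eq_card: "fixed_from m xs = card {i. i < length xs \<and> xs ! i = Suc (m + i)}"
proof (induction xs arbitrary: m)
  case Nil
  then show ?case by simp
next
  case (Cons x xs)
  have "{i. i < length (x # xs) \<and> (x # xs) ! i = Suc (m + i)} =
      (if x = Suc m then {0} else {}) \<union> Suc ` {i. i < length xs \<and> xs ! i = Suc (Suc m + i)}"
    (is "?L = ?R")
  proof (intro set_eqI)
    fix i show "i \<in> ?L \<longleftrightarrow> i \<in> ?R" by (cases i) auto
  qed
  then show ?case
    by (simp add: Cons.IH card_Un_disjoint card_image)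
qed

lemma fixed_points_eq_fixed_from: "fixed_points \<pi> = fixed_from 0 \<pi>"
proof -
  have "{i \<in> {1..length \<pi>}. \<pi> ! (i - 1) = i} = Suc ` {i. i < length \<pi> \<and> \<pi> ! i = Suc (0 + i)}"
  proof (intro set_eqI)
    fix i show "i \<in> {i \<in> {1..length \<pi>}. \<pi> ! (i - 1) = i} \<longleftrightarrow>
        i \<in> Suc ` {i. i < length \<pi> \<and> \<pi> ! i = Suc (0 + i)}"
      by (cases i) auto
  qed
  then show ?thesis
    by (simp add: fixed_points_def fixed_from_eq_card card_image)
qed

lemma fixed_from_le_length: "fixed_from m xs \<le> length xs"
  by (induction xs arbitrary: m) (auto intro: le_SucI)

text \<open>Once the maximum lags behind the number of entries read, it never catches up, because each
  entry raises it by at most 1.\<close>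

lemma fixed_from_eq_0:
  "growth_from m xs \<Longrightarrow> m < p \<Longrightarrow> fixed_from p xs = 0"
  by (induction xs arbitrary: m p) (auto simp: max_def split: if_splits)

text \<open>When the maximum equals the number \<open>m\<close> of entries read, the next entry is a fixed point if it
  raises the maximum, and otherwise no later entry is a fixed point.\<close>

lemma growth_words_none_fixed:
  "{xs \<in> growth_words (Suc n) m. fixed_from m xs = 0} =
     (\<lambda>(x, xs). x # xs) ` ({1..m} \<times> growth_words n m)"
  unfolding growth_words_Suc by (auto simp: growth_words_def fixed_from_eq_0)

lemma growth_words_Suc_fixed:
  "{xs \<in> growth_words (Suc n) m. fixed_from m xs = Suc k} =
     (#) (Suc m) ` {xs \<in> growth_words n (Suc m). fixed_from (Suc m) xs = k}"
  unfolding growth_words_Suc by (auto simp: growth_words_def fixed_from_eq_0)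

lemma card_exactly_fixed:
  assumes "k < n"
  shows "real (card {xs \<in> growth_words n m. fixed_from m xs = k})
    = real (m + k) * Theta (n - k - 1) (m + k)"
  using assms
proof (induction k arbitrary: n m)
  case 0
  then obtain n' where "n = Suc n'" by (cases n) auto
  then show ?case
    by (simp add: growth_words_none_fixed card_keep_maximum[simplified]
        Theta_eq_card_growth_words)
next
  case (Suc k)
  then obtain n' where "n = Suc n'" "k < n'" by (cases n) auto
  then show ?case
    using Suc.IH[of n' "Suc m"] by (simp add: growth_words_Suc_fixed card_image)
qed

lemma card_all_fixed: "card {xs \<in> growth_words n m. fixed_from m xs = n} = 1"
proof (induction n arbitrary: m)
  case 0
  have "{xs \<in> growth_words 0 m. fixed_from m xs = 0} = {[]}"
    by (auto simp: growth_words_0)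
  then show ?case by simp
next
  case (Suc n)
  then show ?case by (simp add: growth_words_Suc_fixed card_image)
qed

section \<open>The distribution of the number of fixed points\<close>

lemma prob_fixed_points:
  assumes "1 \<le> n"
  shows "measure_pmf.prob (pmf_of_set (RGS n)) {\<pi>. fixed_points \<pi> = j}
    = real (card {xs \<in> growth_words n 0. fixed_from 0 xs = j}) / real (Bell n)"
proof -
  have "RGS n \<inter> {\<pi>. fixed_points \<pi> = j} = {xs \<in> growth_words n 0. fixed_from 0 xs = j}"
    using assms by (auto simp: RGS_eq_growth_words fixed_points_eq_fixed_from)
  then show ?thesis
    using assms RGS_nonempty[OF assms] finite_RGS[of n]
    by (simp add: measure_pmf_of_set RGS_eq_growth_words Bell_eq_card_growth_words)
qed

lemma expectation_fixed_points:
  assumes "1 \<le> n"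
  shows "measure_pmf.expectation (pmf_of_set (RGS n)) (\<lambda>\<pi>. real (fixed_points \<pi>))
    = (real n + (\<Sum>j=1..n-1. (real j)\<^sup>2 * Theta (n - j - 1) j)) / real (Bell n)"
proof -
  let ?S = "\<lambda>j. {xs \<in> growth_words n 0. fixed_from 0 xs = j}"
  have "(\<Sum>xs\<in>growth_words n 0. real (fixed_from 0 xs))
      = (\<Sum>j\<in>{0..n}. \<Sum>xs\<in>?S j. real (fixed_from 0 xs))"
    using fixed_from_le_length
    by (intro sum.group[symmetric] finite_growth_words) (auto simp: growth_words_def)
  also have "\<dots> = (\<Sum>j\<in>{0..n}. real j * real (card (?S j)))"
    by (intro sum.cong refl) (simp add: mult.commute)
  also have "{0..n} = insert 0 (insert n {1..n-1})"
    using assms by auto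
  also have "(\<Sum>j\<in>insert 0 (insert n {1..n-1}). real j * real (card (?S j)))
      = real n + (\<Sum>j=1..n-1. real j * real (card (?S j)))"
    using assms card_all_fixed[of n 0] by simp
  also have "(\<Sum>j=1..n-1. real j * real (card (?S j)))
      = (\<Sum>j=1..n-1. (real j)\<^sup>2 * Theta (n - j - 1) j)"
  proof (rule sum.cong)
    fix j assume "j \<in> {1..n-1}"
    then have "j < n" using assms by auto
    then show "real j * real (card (?S j)) = (real j)\<^sup>2 * Theta (n - j - 1) j"
      using card_exactly_fixed[of j n 0] by (simp add: power2_eq_square)
  qed simp
  finally show ?thesis
    using assms RGS_nonempty[OF assms] finite_RGS[of n]
    by (simp add: integral_pmf_of_set RGS_eq_growth_words Bell_eq_card_growth_words
        fixed_points_eq_fixed_from)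
qed

text \<open>For \<open>1 < n\<close>, the case of one fixed point is the general formula \<open>1 \<cdot> \<Theta>\<^bsub>n-2\<^esub>(1)\<close>, and this is
  \<open>B\<^bsub>n-1\<^esub>\<close> because a restricted growth sequence of length \<open>n - 1\<close> is the entry 1 followed by a
  continuation from maximum 1.\<close>

theorem theorem4:
  fixes n :: nat
  assumes "n \<ge> 1"
  shows "(\<forall>j\<in>{1..n}.
      (j = 1 \<longrightarrow> measure_pmf.prob (pmf_of_set (RGS n)) {\<pi>. fixed_points \<pi> = j}
                = real (Bell (n - 1)) / real (Bell n)) \<and>
      (1 < j \<and> j < n \<longrightarrow> measure_pmf.prob (pmf_of_set (RGS n)) {\<pi>. fixed_points \<pi> = j}
                = real j * Theta (n - j - 1) j / real (Bell n)) \<and>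
      (j = n \<longrightarrow> measure_pmf.prob (pmf_of_set (RGS n)) {\<pi>. fixed_points \<pi> = j}
                = 1 / real (Bell n))) \<and>
    (n \<ge> 2 \<longrightarrow>
      measure_pmf.expectation (pmf_of_set (RGS n)) (\<lambda>\<pi>. real (fixed_points \<pi>))
        = (real n + (\<Sum>j=1..n-1. (real j)\<^sup>2 * Theta (n - j - 1) j)) / real (Bell n))"
proof (intro conjI ballI impI)
  fix j :: nat assume "j = 1"
  show "measure_pmf.prob (pmf_of_set (RGS n)) {\<pi>. fixed_points \<pi> = j}
      = real (Bell (n - 1)) / real (Bell n)"
  proof (cases "n = 1")
    case True
    then show ?thesis
      using \<open>j = 1\<close> card_all_fixed[of 1 0]
      by (simp add: prob_fixed_points Bell_eq_card_growth_words growth_words_0)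
  next
    case False
    then obtain n' where n': "n = Suc (Suc n')" using assms
      by (metis One_nat_def not0_implies_Suc not_one_le_zero)
    have "real (card {xs \<in> growth_words n 0. fixed_from 0 xs = j}) = real (card (growth_words n' 1))"
      using card_exactly_fixed[of 1 n 0] \<open>j = 1\<close> n' by (simp add: Theta_eq_card_growth_words)
    also have "card (growth_words n' 1) = Bell (n - 1)"
      by (simp add: n' Bell_eq_card_growth_words card_growth_words_Suc)
    finally show ?thesis
      using assms by (simp add: prob_fixed_points)
  qed
next
  fix j :: nat assume "1 < j \<and> j < n"
  then show "measure_pmf.prob (pmf_of_set (RGS n)) {\<pi>. fixed_points \<pi> = j}
      = real j * Theta (n - j - 1) j / real (Bell n)"
    using card_exactly_fixed[of j n 0] assms by (simp add: prob_fixed_points)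
next
  fix j :: nat assume "j = n"
  then show "measure_pmf.prob (pmf_of_set (RGS n)) {\<pi>. fixed_points \<pi> = j} = 1 / real (Bell n)"
    using card_all_fixed[of n 0] assms by (simp add: prob_fixed_points)
next
  assume "n \<ge> 2"
  show "measure_pmf.expectation (pmf_of_set (RGS n)) (\<lambda>\<pi>. real (fixed_points \<pi>))
      = (real n + (\<Sum>j=1..n-1. (real j)\<^sup>2 * Theta (n - j - 1) j)) / real (Bell n)"
    using assms by (rule expectation_fixed_points)
qed

end
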